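(* Let $G$ be a finite abelian group with $|G|=m$ and let $A\subseteq G$ satisfy $R_A(g)\le 5$ for all $g\in G$. Then $$|\{g\in G:\ R_A(g)=2\}|\ \le\ \frac{1}{2}m+3\sqrt{5m}.$$
   Context: For a subset $A$ of an abelian group $G$ (written additively) and $g\in G$, $R_A(g)$ denotes the number of ordered pairs $(a,a')\in A\times A$ with $a+a'=g$. *)

theory Defs
  imports Complex_Main
begin

definition rep_count :: "'a::ab_group_add set \<Rightarrow> 'a \<Rightarrow> nat" where
  "rep_count A g = card {(a, a'). a \<in> A \<and> a' \<in> A \<and> a + a' = g}"

end

theory Submission
  imports Defs
begin

text \<open>
  Let \<open>n = |A|\<close>, let \<open>R\<close> count sums and \<open>D\<close> count differences. Both satisfy
  \<open>\<Sum>R = \<Sum>D = n\<^sup>2\<close>, and \<open>\<Sum>R\<^sup>2 = \<Sum>D\<^sup>2\<close> (the additive energy). As \<open>D\<close> takes integer values,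
  \<open>(D - 1)(D - 2) \<ge> 0\<close>, hence \<open>\<Sum>D\<^sup>2 \<ge> 3n\<^sup>2 - 2m + (n - 1)(n - 2)\<close>, the last term coming from
  \<open>D(0) = n\<close>. Thus \<open>\<Sum>(4R - R\<^sup>2) \<le> 2m + 3n\<close>. The summand is \<open>4\<close> where \<open>R = 2\<close> and is negative
  only where \<open>R = 5\<close>, where it is \<open>-5\<close>. By the symmetry \<open>(a, a') \<mapsto> (a', a)\<close>, \<open>R(g)\<close> is odd
  only if \<open>g = 2a\<close> with \<open>a \<in> A\<close>, so this happens at most \<open>n\<close> times. Therefore
  \<open>4 |{R = 2}| \<le> 2m + 8n\<close>, and \<open>n\<^sup>2 = \<Sum>R \<le> 5m\<close>.
\<close>

definition diff_count :: "'a::ab_group_add set \<Rightarrow> 'a \<Rightarrow> nat" where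
  "diff_count A d = card {(a, a'). a \<in> A \<and> a' \<in> A \<and> a - a' = d}"

lemma rep_count_alt: "rep_count A g = card {p \<in> A \<times> A. fst p + snd p = g}"
  unfolding rep_count_def by (rule arg_cong[where f = card]) auto

lemma diff_count_alt: "diff_count A d = card {p \<in> A \<times> A. fst p - snd p = d}"
  unfolding diff_count_def by (rule arg_cong[where f = card]) auto

lemma sum_card_fibres:
  fixes f :: "'b \<Rightarrow> 'c::finite"
  assumes "finite P"
  shows "(\<Sum>g\<in>UNIV. card {p \<in> P. f p = g}) = card P"
  using sum.group[OF assms finite subset_UNIV, where g = f and h = "\<lambda>_. 1 :: nat"] by simp

text \<open>The square of a fibre's size counts ordered pairs inside that fibre; grouping the pairs
  with \<open>f p = f q\<close> by their common value gives the sum.\<close>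

lemma sum_card_fibres_square:
  fixes f :: "'b \<Rightarrow> 'c::finite"
  assumes "finite P"
  shows "(\<Sum>g\<in>UNIV. (card {p \<in> P. f p = g})\<^sup>2) = card {(p, q). p \<in> P \<and> q \<in> P \<and> f p = f q}"
proof -
  let ?Q = "{(p, q). p \<in> P \<and> q \<in> P \<and> f p = f q}"
  have fin: "finite ?Q"
    by (rule finite_subset[OF _ finite_cartesian_product[OF assms assms]]) auto
  have "(card {p \<in> P. f p = g})\<^sup>2 = card {r \<in> ?Q. f (fst r) = g}" for g
  proof -
    have "{r \<in> ?Q. f (fst r) = g} = {p \<in> P. f p = g} \<times> {p \<in> P. f p = g}" by auto
    then show ?thesis by (simp add: card_cartesian_product power2_eq_square)
  qed
  then show ?thesis using sum_card_fibres[OF fin, of "\<lambda>r. f (fst r)"] by simp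
qed

lemma sum_rep_count:
  fixes A :: "'a::{finite, ab_group_add} set"
  shows "(\<Sum>g\<in>UNIV. rep_count A g) = (card A)\<^sup>2"
  unfolding rep_count_alt
  by (subst sum_card_fibres) (simp_all add: card_cartesian_product power2_eq_square)

lemma sum_diff_count:
  fixes A :: "'a::{finite, ab_group_add} set"
  shows "(\<Sum>d\<in>UNIV. diff_count A d) = (card A)\<^sup>2"
  unfolding diff_count_alt
  by (subst sum_card_fibres) (simp_all add: card_cartesian_product power2_eq_square)

text \<open>Both sides count additive quadruples: moving terms across turns
  \<open>a + b = c + d\<close> into \<open>a - c = d - b\<close>, so regrouping the same four
  elements is a bijection.\<close>

lemma sum_rep_count_square:
  fixes A :: "'a::{finite, ab_group_add} set"
  shows "(\<Sum>g\<in>UNIV. (rep_count A g)\<^sup>2) = (\<Sum>d\<in>UNIV. (diff_count A d)\<^sup>2)"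
proof -
  have rearrange: "a + b = c + d \<longleftrightarrow> a - c = d - b" for a b c d :: 'a
  proof -
    have "(a - c) + (b + c) = a + b" "(d - b) + (b + c) = c + d" by (simp_all add: algebra_simps)
    then show ?thesis by (metis add_right_cancel)
  qed
  show ?thesis
    unfolding rep_count_alt diff_count_alt sum_card_fibres_square[OF finite]
    by (rule bij_betw_same_card[of "\<lambda>((a, b), (c, d)). ((a, c), (d, b))"],
        rule bij_betw_byWitness[where f' = "\<lambda>((a, c), (d, b)). ((a, b), (c, d))"])
      (auto simp only: rearrange mem_Collect_eq case_prod_conv mem_Sigma_iff fst_conv snd_conv
        image_subset_iff Ball_def split_paired_All)
qed

lemma diff_count_zero:
  fixes A :: "'a::{finite, ab_group_add} set"
  shows "diff_count A 0 = card A"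
proof -
  have "{(a, a'). a \<in> A \<and> a' \<in> A \<and> a - a' = 0} = (\<lambda>a. (a, a)) ` A" by auto
  then show ?thesis by (simp add: diff_count_def card_image inj_on_def)
qed

text \<open>The orbits \<open>{x, f x}\<close> partition \<open>X\<close> into blocks of size
  two.\<close>

lemma even_card_fixpoint_free_involution:
  assumes "finite X" and "\<And>x. x \<in> X \<Longrightarrow> f x \<in> X"
    and "\<And>x. x \<in> X \<Longrightarrow> f (f x) = x" and "\<And>x. x \<in> X \<Longrightarrow> f x \<noteq> x"
  shows "even (card X)"
proof -
  let ?C = "(\<lambda>x. {x, f x}) ` X"
  have U: "\<Union>?C = X" using assms(2) by auto
  have "2 * card ?C = card (\<Union>?C)"
  proof (rule card_partition)
    show "finite ?C" "finite (\<Union>?C)" using assms(1) U by auto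
    show "card c = 2" if "c \<in> ?C" for c
      using that assms(4) by (auto simp: card_2_iff)
    show "c1 \<inter> c2 = {}" if "c1 \<in> ?C" "c2 \<in> ?C" "c1 \<noteq> c2" for c1 c2
      using that assms(3) by (auto; metis)
  qed
  then show ?thesis unfolding U by (metis dvd_triv_left)
qed

lemma odd_rep_count_imp_double:
  fixes A :: "'a::{finite, ab_group_add} set"
  assumes "odd (rep_count A g)"
  shows "\<exists>a\<in>A. a + a = g"
proof (rule ccontr)
  assume "\<not> ?thesis"
  then have no_double: "a + a \<noteq> g" if "a \<in> A" for a using that by blast
  let ?X = "{(a, a'). a \<in> A \<and> a' \<in> A \<and> a + a' = g}"
  \<comment> \<open>A pair fixed by the swap would be \<open>(a, a)\<close> with
    \<open>a + a = g\<close>, which \<open>no_double\<close> excludes.\<close>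
  have "even (card ?X)"
  proof (rule even_card_fixpoint_free_involution[where f = prod.swap])
    fix x assume x: "x \<in> ?X"
    then show "prod.swap x \<in> ?X" by (auto simp: add.commute)
    show "prod.swap (prod.swap x) = x" by simp
    from x no_double show "prod.swap x \<noteq> x"
      by (metis (mono_tags, lifting) case_prodE mem_Collect_eq swap_simp Pair_inject)
  qed simp
  with assms show False by (simp add: rep_count_def)
qed

lemma card_odd_rep_count:
  fixes A :: "'a::{finite, ab_group_add} set"
  shows "card {g. odd (rep_count A g)} \<le> card A"
  by (rule surj_card_le[where f = "\<lambda>a. a + a"]) (auto dest!: odd_rep_count_imp_double)

lemma additive_energy_ge:
  fixes A :: "'a::{finite, ab_group_add} set"
  shows "(\<Sum>g\<in>UNIV. (int (rep_count A g))\<^sup>2)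
    \<ge> 3 * (int (card A))\<^sup>2 - 2 * int (card (UNIV :: 'a set)) + (int (card A) - 1) * (int (card A) - 2)"
proof -
  let ?D = "\<lambda>d. int (diff_count A d)"
  have nonneg: "(?D d - 1) * (?D d - 2) \<ge> 0" for d
    by (cases "diff_count A d \<le> 1") (auto intro: mult_nonpos_nonpos)
  \<comment> \<open>Only the term at \<open>d = 0\<close> is kept; it is quadratic in
    \<open>card A\<close>.\<close>
  have "(?D 0 - 1) * (?D 0 - 2) \<le> (\<Sum>d\<in>UNIV. (?D d - 1) * (?D d - 2))"
    by (rule member_le_sum) (use nonneg in auto)
  also have "\<dots> = (\<Sum>d\<in>UNIV. (?D d)\<^sup>2 - 3 * ?D d + 2)"
    by (simp add: algebra_simps power2_eq_square)
  also have "\<dots> = (\<Sum>d\<in>UNIV. (?D d)\<^sup>2) - 3 * int (\<Sum>d\<in>UNIV. diff_count A d)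
      + 2 * int (card (UNIV :: 'a set))"
    by (simp add: sum.distrib sum_subtractf sum_distrib_left)
  also have "(\<Sum>d\<in>UNIV. (?D d)\<^sup>2) = (\<Sum>g\<in>UNIV. (int (rep_count A g))\<^sup>2)"
    using arg_cong[OF sum_rep_count_square[of A], of int] by simp
  finally show ?thesis by (simp add: sum_diff_count diff_count_zero)
qed

theorem theorem1p2:
  fixes A :: "'a::{finite, ab_group_add} set" and m :: nat
  assumes "card (UNIV :: 'a set) = m"
    and "\<And>g. rep_count A g \<le> 5"
  shows "real (card {g. rep_count A g = 2}) \<le> 1 / 2 * real m + 3 * sqrt (5 * real m)"
proof -
  let ?R = "\<lambda>g. int (rep_count A g)"
  let ?n = "int (card A)"
  \<comment> \<open>For R = 0, ..., 5 the value of 4R - R^2 is 0, 3, 4, 3, 0, -5. The weight 5 on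
    odd R cancels the -5; the surplus at 1 and 3 is given away.\<close>
  have "4 * (if rep_count A g = 2 then 1 else 0)
      \<le> 4 * ?R g - (?R g)\<^sup>2 + 5 * (if odd (rep_count A g) then 1 else 0)" for g
  proof -
    have "rep_count A g \<in> {0, 1, 2, 3, 4, 5}" using assms(2)[of g] by auto
    then show ?thesis by auto
  qed
  then have "(\<Sum>g\<in>UNIV. 4 * (if rep_count A g = 2 then 1 else 0))
      \<le> (\<Sum>g\<in>UNIV. 4 * ?R g - (?R g)\<^sup>2 + 5 * (if odd (rep_count A g) then 1 else 0))"
    by (rule sum_mono)
  then have "4 * int (card {g. rep_count A g = 2})
      \<le> 4 * int (\<Sum>g\<in>UNIV. rep_count A g) - (\<Sum>g\<in>UNIV. (?R g)\<^sup>2)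
        + 5 * int (card {g. odd (rep_count A g)})"
    by (simp add: sum.distrib sum_subtractf sum_distrib_left[symmetric] sum.If_cases)
  \<comment> \<open>With this expansion the energy bound reads 4n^2 - 2m - 3n + 2, so the quadratic
    terms cancel and 3n + 5n = 8n remains.\<close>
  moreover have "(?n - 1) * (?n - 2) = ?n\<^sup>2 - 3 * ?n + 2"
    by (simp add: algebra_simps power2_eq_square)
  ultimately have "4 * int (card {g. rep_count A g = 2}) \<le> 2 * int m + 8 * ?n"
    using additive_energy_ge[of A] card_odd_rep_count[of A] assms(1)
    by (simp add: sum_rep_count)
  then have "4 * real (card {g. rep_count A g = 2}) \<le> 2 * real m + 8 * real (card A)"
    by linarith
  moreover have "real (card A) \<le> sqrt (5 * real m)"
  proof (rule real_le_rsqrt)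
    have "(card A)\<^sup>2 \<le> 5 * m"
      using sum_mono[of UNIV "rep_count A" "\<lambda>_. 5"] assms by (simp add: sum_rep_count)
    then show "(real (card A))\<^sup>2 \<le> 5 * real m"
      by (metis of_nat_le_iff of_nat_mult of_nat_numeral of_nat_power)
  qed
  \<comment> \<open>The bounds above already give the factor 2 before the root; nonnegativity
    relaxes it to 3.\<close>
  moreover have "0 \<le> sqrt (5 * real m)" by simp
  ultimately show ?thesis by argo
qed

end
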